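(* Let $X$ be a separable metric space, let $S\subset C(\mathbb{R},X)$ be a compact shift-invariant subset, and let $\mu$ be an invariant measure of $S$. Then the closure in $X$ of the set of all recurrent points for $S$ is a full-measure set, i.e. it has $\mu$-measure $1$.
   Context: $C(\mathbb{R},X)$ carries the compact-open topology (uniform convergence on compact sets). The shift is $\sigma(t,\phi)(s)=\phi(s+t)$; $S\subset C(\mathbb{R},X)$ is shift-invariant if $\sigma(t,\phi)\in S$ for all $\phi\in S$, $t\in\mathbb{R}$. Let $\pi(\phi)=\phi(0)$. A Borel probability measure $\mu$ on $X$ is invariant for $S$ if there exists a Borel probability measure $\nu$ on $S$ that is invariant under the shift flow $\sigma$ on $S$ and satisfies $\mu=\pi_*\nu$. For $B\subset S$, $\omega(B)=\bigcap_{t>0}\overline{\bigcup_{s\ge t}\sigma(s,B)}$ (closure in $S$). For $x\in X$, let $S_x=\{\phi\in S : \phi(0)=x\}$ and $\omega_S(x)=\pi(\omega(S_x))$. A point $x\in X$ is recurrent for $S$ if $x\in\omega_S(x)$. *)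

theory Defs
  imports "HOL-Probability.Probability"
begin

definition compact_open_topology :: "(real \<Rightarrow> 'a::topological_space) topology" where
  "compact_open_topology =
     topology_generated_by
       {{\<phi>. continuous_on UNIV \<phi> \<and> \<phi> ` K \<subseteq> U} | K U. compact K \<and> open U}"

lemma topspace_compact_open:
  "topspace (compact_open_topology :: (real \<Rightarrow> 'a::topological_space) topology)
     = {\<phi>. continuous_on UNIV \<phi>}"
proof -
  let ?B = "{{\<phi> :: real \<Rightarrow> 'a. continuous_on UNIV \<phi> \<and> \<phi> ` K \<subseteq> U} | K U. compact K \<and> open U}"
  have "{\<phi> :: real \<Rightarrow> 'a. continuous_on UNIV \<phi>} \<in> ?B"
    by (rule CollectI, rule exI[of _ "{}"], rule exI[of _ UNIV]) auto
  then have "\<Union>?B = {\<phi> :: real \<Rightarrow> 'a. continuous_on UNIV \<phi>}"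
    by blast
  then show ?thesis
    by (simp only: compact_open_topology_def topology_generated_by_topspace)
qed

definition shift :: "real \<Rightarrow> (real \<Rightarrow> 'a) \<Rightarrow> real \<Rightarrow> 'a" where
  "shift t \<phi> = (\<lambda>s. \<phi> (s + t))"

definition shift_invariant :: "(real \<Rightarrow> 'a) set \<Rightarrow> bool" where
  "shift_invariant S \<longleftrightarrow> (\<forall>\<phi>\<in>S. \<forall>t. shift t \<phi> \<in> S)"

definition eval0 :: "(real \<Rightarrow> 'a) \<Rightarrow> 'a" where
  "eval0 \<phi> = \<phi> 0"

definition borel_on :: "(real \<Rightarrow> 'a::topological_space) set \<Rightarrow> (real \<Rightarrow> 'a) measure" where
  "borel_on S = sigma S {U. openin (subtopology compact_open_topology S) U}"

definition invariant_measure ::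
    "(real \<Rightarrow> 'a::topological_space) set \<Rightarrow> 'a measure \<Rightarrow> bool" where
  "invariant_measure S \<mu> \<longleftrightarrow>
     prob_space \<mu> \<and> sets \<mu> = sets borel \<and>
     (\<exists>\<nu>. prob_space \<nu> \<and> sets \<nu> = sets (borel_on S) \<and>
          (\<forall>t. distr \<nu> \<nu> (shift t) = \<nu>) \<and>
          \<mu> = distr \<nu> borel eval0)"

definition omega_limit :: "(real \<Rightarrow> 'a::topological_space) set \<Rightarrow> (real \<Rightarrow> 'a) set \<Rightarrow> (real \<Rightarrow> 'a) set" where
  "omega_limit S B =
     (\<Inter>t\<in>{0<..}. subtopology compact_open_topology S closure_of (\<Union>s\<in>{t..}. shift s ` B))"

definition omega_point :: "(real \<Rightarrow> 'a::topological_space) set \<Rightarrow> 'a \<Rightarrow> 'a set" where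
  "omega_point S x = eval0 ` omega_limit S {\<phi>\<in>S. \<phi> 0 = x}"

definition recurrent :: "(real \<Rightarrow> 'a::topological_space) set \<Rightarrow> 'a \<Rightarrow> bool" where
  "recurrent S x \<longleftrightarrow> x \<in> omega_point S x"

text \<open>\<open>distr\<close> is a genuine push-forward only along measurable maps; the lemmas
  \<open>measurable_eval0\<close> and \<open>measurable_shift\<close> show that this is so for both uses in \<open>invariant_measure\<close>.\<close>

lemma space_borel_on: "space (borel_on S) = S"
  by (simp add: borel_on_def space_measure_of_conv)

lemma sets_borel_onI:
  "openin (subtopology compact_open_topology S) U \<Longrightarrow> U \<in> sets (borel_on S)"
  by (subst borel_on_def, rule in_measure_of) (use openin_subset in fastforce)+

lemma compact_open_topology_subbasis:
  assumes "compact K" "open U"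
  shows "openin compact_open_topology {\<phi>. continuous_on UNIV \<phi> \<and> \<phi> ` K \<subseteq> U}"
  unfolding compact_open_topology_def
  using assms by (intro topology_generated_by_Basis) blast

lemma measurable_eval0:
  fixes S :: "(real \<Rightarrow> 'a::topological_space) set"
  assumes "S \<subseteq> topspace compact_open_topology"
  shows "eval0 \<in> borel_measurable (borel_on S)"
proof (rule borel_measurableI)
  fix U :: "'a set" assume "open U"
  then have "openin compact_open_topology {\<phi>. continuous_on UNIV \<phi> \<and> \<phi> ` {0} \<subseteq> U}"
    by (intro compact_open_topology_subbasis) auto
  moreover have "eval0 -` U \<inter> space (borel_on S)
      = {\<phi>. continuous_on UNIV \<phi> \<and> \<phi> ` {0} \<subseteq> U} \<inter> S"
    using assms by (auto simp: eval0_def space_borel_on topspace_compact_open)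
  ultimately show "eval0 -` U \<inter> space (borel_on S) \<in> sets (borel_on S)"
    by (intro sets_borel_onI) (auto simp: openin_subtopology)
qed

lemma continuous_on_shift: "continuous_on UNIV \<phi> \<Longrightarrow> continuous_on UNIV (shift t \<phi>)"
  unfolding shift_def by (rule continuous_on_compose2) (auto intro!: continuous_intros)

lemma continuous_map_shift:
  "continuous_map compact_open_topology compact_open_topology
     (shift t :: (real \<Rightarrow> 'a::topological_space) \<Rightarrow> _)"
proof -
  let ?B = "{{\<phi> :: real \<Rightarrow> 'a. continuous_on UNIV \<phi> \<and> \<phi> ` K \<subseteq> U} | K U. compact K \<and> open U}"
  have "continuous_map compact_open_topology (topology_generated_by ?B)
      (shift t :: (real \<Rightarrow> 'a) \<Rightarrow> _)"
  proof (rule continuous_on_generated_topo)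
    fix V assume "V \<in> ?B"
    then obtain K U where V: "V = {\<phi>. continuous_on UNIV \<phi> \<and> \<phi> ` K \<subseteq> U}" "compact K" "open U"
      by blast
    have "shift t -` V \<inter> topspace compact_open_topology =
        {\<phi>. continuous_on UNIV \<phi> \<and> \<phi> ` ((\<lambda>s. s + t) ` K) \<subseteq> U}"
      by (auto simp: V topspace_compact_open continuous_on_shift image_subset_iff)
         (auto simp: shift_def)
    moreover have "compact ((\<lambda>s. s + t) ` K)"
      by (intro compact_continuous_image V continuous_intros)
    ultimately show "openin compact_open_topology (shift t -` V \<inter> topspace compact_open_topology)"
      using V(3) by (simp only: compact_open_topology_subbasis)
  next
    have "\<Union>?B = {\<phi>. continuous_on UNIV \<phi>}"
      using topspace_compact_open[where 'a = 'a]
      by (simp only: compact_open_topology_def topology_generated_by_topspace)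
    then show "shift t ` topspace compact_open_topology \<subseteq> \<Union>?B"
      by (auto simp only: topspace_compact_open continuous_on_shift)
  qed
  then show ?thesis
    by (simp only: compact_open_topology_def)
qed

lemma measurable_shift:
  fixes S :: "(real \<Rightarrow> 'a::topological_space) set"
  assumes "S \<subseteq> topspace compact_open_topology" "shift_invariant S"
  shows "shift t \<in> measurable (borel_on S) (borel_on S)"
proof -
  let ?T = "subtopology compact_open_topology S"
  have maps: "shift t \<in> S \<rightarrow> S"
    using assms(2) by (auto simp: shift_invariant_def)
  have pre: "shift t -` U \<inter> S \<in> sets (borel_on S)" if U: "openin ?T U" for U
  proof -
    obtain V where V: "openin compact_open_topology V" "U = V \<inter> S"
      using U by (auto simp: openin_subtopology)
    have "openin compact_open_topology {\<phi> \<in> topspace compact_open_topology. shift t \<phi> \<in> V}"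
      using continuous_map_shift V(1) by (rule openin_continuous_map_preimage)
    moreover have "shift t -` U \<inter> S
        = {\<phi> \<in> topspace compact_open_topology. shift t \<phi> \<in> V} \<inter> S"
      using assms(1) maps V(2) by auto
    ultimately show ?thesis
      by (intro sets_borel_onI) (auto simp: openin_subtopology)
  qed
  have "shift t \<in> measurable (borel_on S) (sigma S {U. openin ?T U})"
  proof (rule measurable_measure_of)
    show "{U. openin ?T U} \<subseteq> Pow S"
      using openin_subset by fastforce
  qed (use maps pre in \<open>auto simp: space_borel_on\<close>)
  then show ?thesis
    by (simp only: borel_on_def)
qed

end

theory Submission
  imports Defs
begin

text \<open>
  A point \<open>x\<close> is recurrent as soon as one single trajectory in \<open>S\<close> that starts at \<open>x\<close> keeps returning
  near \<open>x\<close>, and almost every trajectory returns near its own starting point.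

  Let \<open>\<nu>\<close> be a shift-invariant measure on \<open>S\<close> with image \<open>\<mu>\<close>. Apply Poincare's recurrence theorem
  to the time-one shift and to the sets of trajectories that start in a fixed ball of \<open>X\<close>
  (\<open>Poincare_recurrence\<close>). Separability leaves only countably many balls to treat, so \<open>\<nu>\<close>-almost
  every \<open>\<phi>\<close> returns to each neighbourhood of \<open>\<phi> 0\<close> at arbitrarily late times
  (\<open>AE_returns_near_start\<close>). This yields times \<open>n\<close> for which \<open>\<phi> n\<close> approaches \<open>\<phi> 0\<close>, but not
  yet a trajectory in the omega-limit set. Such a trajectory comes from compactness of \<open>S\<close>: each
  closed tail of the orbit of the fibre has a compact, hence closed, image in \<open>X\<close>, so it contains a
  trajectory starting exactly at \<open>\<phi> 0\<close>, and the tails are nested (\<open>recurrent_if_returns\<close>).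

  Hence \<open>\<nu>\<close>-almost every \<open>\<phi>\<close> has a recurrent starting point. Since the closure of the set of recurrent
  points is Borel, this transfers along evaluation at \<open>0\<close> to a statement about its \<open>\<mu>\<close>-measure.
\<close>

section \<open>Poincare recurrence\<close>

text \<open>
  The points that enter \<open>A\<close> at time \<open>n\<close> or later form a decreasing sequence of sets, each of which is
  the preimage of the one before it. They all have the same finite measure, so they agree
  up to null sets; and the first of them contains \<open>A\<close>.
\<close>

lemma (in finite_measure) Poincare_recurrence:
  assumes T [measurable]: "T \<in> measurable M M"
    and inv: "distr M M T = M"
    and A [measurable]: "A \<in> sets M"
  shows "AE x in M. x \<in> A \<longrightarrow> (\<forall>n. \<exists>k\<ge>n. (T ^^ k) x \<in> A)"
proof -
  define E where "E n = {x \<in> space M. \<exists>k\<ge>n. (T ^^ k) x \<in> A}" for n :: nat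
  have Tk [measurable]: "(T ^^ k) \<in> measurable M M" for k
    by (rule measurable_compose_n) (rule T)
  have E_sets: "E n \<in> sets M" for n
    unfolding E_def by measurable
  have shift_E: "T -` E n \<inter> space M = E (Suc n)" for n
  proof (intro equalityI subsetI)
    fix x assume "x \<in> T -` E n \<inter> space M"
    then obtain k where "k \<ge> n" "(T ^^ Suc k) x \<in> A" "x \<in> space M"
      by (auto simp: E_def funpow_Suc_right simp del: funpow.simps)
    then show "x \<in> E (Suc n)"
      unfolding E_def mem_Collect_eq by (meson Suc_le_mono)
  next
    fix x assume "x \<in> E (Suc n)"
    then obtain k where k: "k \<ge> Suc n" "(T ^^ k) x \<in> A" "x \<in> space M"
      by (auto simp: E_def)
    then obtain j where "k = Suc j" "j \<ge> n"
      by (cases k) auto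
    with k show "x \<in> T -` E n \<inter> space M"
      using measurable_space[OF T]
      by (auto simp: E_def funpow_Suc_right simp del: funpow.simps)
  qed
  have "measure M (E (Suc n)) = measure M (E n)" for n
    using measure_distr[OF T E_sets] by (simp add: inv shift_E)
  then have same: "measure M (E n) = measure M (E 0)" for n
    by (induction n) auto
  have "AE x in M. x \<notin> E 0 - E n" for n
  proof (rule AE_not_in)
    have "E n \<subseteq> E 0"
      by (auto simp: E_def)
    then have "measure M (E 0 - E n) = 0"
      using E_sets by (simp add: finite_measure_Diff same[of n])
    then show "E 0 - E n \<in> null_sets M"
      using E_sets by (auto simp: null_sets_def emeasure_eq_measure)
  qed
  then have "AE x in M. \<forall>n. x \<notin> E 0 - E n"
    unfolding AE_all_countable by blast
  then show ?thesis
  proof (rule AE_mp, intro AE_I2 impI allI)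
    fix x n assume x: "x \<in> space M" "\<forall>n. x \<notin> E 0 - E n" "x \<in> A"
    then have "x \<in> E 0"
      unfolding E_def mem_Collect_eq by (metis funpow_0 le0)
    with x have "x \<in> E n"
      by blast
    then show "\<exists>k\<ge>n. (T ^^ k) x \<in> A"
      by (simp add: E_def)
  qed
qed

section \<open>Trajectories that return near their starting point\<close>

lemma funpow_shift: "(shift t ^^ k) \<phi> = shift (real k * t) \<phi>"
  by (induction k) (simp_all add: shift_def distrib_right add.assoc)

text \<open>
  Any ball around \<open>\<phi> 0\<close> contains a ball from the countable family that also contains \<open>\<phi> 0\<close>, which is
  why countably many exceptional null sets suffice.
\<close>

lemma AE_returns_near_start:
  fixes S :: "(real \<Rightarrow> 'a::metric_space) set"
  assumes sep: "separable_space (euclidean :: 'a topology)"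
    and S: "S \<subseteq> topspace compact_open_topology" "shift_invariant S"
    and fin: "finite_measure \<nu>"
    and sets: "sets \<nu> = sets (borel_on S)"
    and inv: "distr \<nu> \<nu> (shift 1) = \<nu>"
  shows "AE \<phi> in \<nu>. \<forall>e>0. \<forall>n. \<exists>k\<ge>n. dist (\<phi> (real k)) (\<phi> 0) < e"
proof -
  interpret finite_measure \<nu> by (rule fin)
  obtain D :: "'a set" where D: "countable D" "closure D = UNIV"
    using sep by (auto simp: separable_space_def)
  have shift_meas: "shift 1 \<in> measurable \<nu> \<nu>"
    using measurable_shift[OF S, of 1] measurable_cong_sets[OF sets sets] by simp
  have eval_meas: "eval0 \<in> borel_measurable \<nu>"
    using measurable_eval0[OF S(1)] by (subst measurable_cong_sets[OF sets refl])
  have "AE \<phi> in \<nu>. \<phi> 0 \<in> ball d r \<longrightarrow> (\<forall>n. \<exists>k\<ge>n. \<phi> (real k) \<in> ball d r)" for d r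
  proof -
    have "eval0 -` ball d r \<inter> space \<nu> \<in> sets \<nu>"
      using eval_meas by (rule measurable_sets) simp
    from Poincare_recurrence[OF shift_meas inv this]
    show ?thesis
      by (rule AE_mp, intro AE_I2)
         (auto simp: funpow_shift eval0_def shift_def)
  qed
  then have "AE \<phi> in \<nu>. \<forall>d\<in>D. \<forall>m. \<phi> 0 \<in> ball d (inverse (real (Suc m))) \<longrightarrow>
      (\<forall>n. \<exists>k\<ge>n. \<phi> (real k) \<in> ball d (inverse (real (Suc m))))"
    unfolding AE_ball_countable[OF D(1)] AE_all_countable by (intro ballI allI)
  then show ?thesis
  proof (rule AE_mp, intro AE_I2 impI allI)
    fix \<phi> :: "real \<Rightarrow> 'a" and e :: real and n :: nat
    assume ret: "\<forall>d\<in>D. \<forall>m. \<phi> 0 \<in> ball d (inverse (real (Suc m))) \<longrightarrow>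
      (\<forall>n. \<exists>k\<ge>n. \<phi> (real k) \<in> ball d (inverse (real (Suc m))))" and "e > 0"
    obtain m where m: "inverse (real (Suc m)) < e / 2"
      using reals_Archimedean[of "e / 2"] \<open>e > 0\<close> by auto
    have "\<phi> 0 \<in> closure D"
      using D(2) by simp
    then obtain d where d: "d \<in> D" "dist d (\<phi> 0) < inverse (real (Suc m))"
      unfolding closure_approachable
      by (metis inverse_positive_iff_positive of_nat_0_less_iff zero_less_Suc)
    then obtain k where k: "k \<ge> n" "dist d (\<phi> (real k)) < inverse (real (Suc m))"
      using ret[rule_format, of d m n] by auto
    have "dist (\<phi> (real k)) (\<phi> 0) < e"
      using dist_triangle3[of "\<phi> (real k)" "\<phi> 0" d] d(2) k(2) m by linarith
    with k(1) show "\<exists>k\<ge>n. dist (\<phi> (real k)) (\<phi> 0) < e"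
      by blast
  qed
qed

section \<open>From returning trajectories to recurrent points\<close>

lemma continuous_map_eval0:
  "continuous_map compact_open_topology euclidean (eval0 :: (real \<Rightarrow> 'a::topological_space) \<Rightarrow> 'a)"
  unfolding continuous_map_def
proof (intro conjI allI impI)
  fix U :: "'a set" assume "openin euclidean U"
  then have "openin compact_open_topology {\<phi>. continuous_on UNIV \<phi> \<and> \<phi> ` {0} \<subseteq> U}"
    by (intro compact_open_topology_subbasis) simp_all
  then show "openin compact_open_topology {\<phi> \<in> topspace compact_open_topology. eval0 \<phi> \<in> U}"
    by (simp add: topspace_compact_open eval0_def)
qed auto

text \<open>
  A limit of the returns \<open>\<phi> k\<close> in \<open>X\<close> has to be lifted to a limit in \<open>S\<close>. No convergent subsequence
  of shifts is extracted: evaluation at \<open>0\<close> maps a closed subset of the compact space \<open>S\<close>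
  onto a compact, hence closed, subset of \<open>X\<close>, so every closed tail meets the fibre over \<open>\<phi> 0\<close>, and
  a nested sequence of nonempty closed sets in a compact space has a common point.
\<close>

lemma recurrent_if_returns:
  fixes S :: "(real \<Rightarrow> 'a::metric_space) set"
  assumes comp: "compactin compact_open_topology S"
    and inv: "shift_invariant S"
    and \<phi>: "\<phi> \<in> S"
    and ret: "\<forall>e>0. \<forall>n. \<exists>k\<ge>n. dist (\<phi> (real k)) (\<phi> 0) < e"
  shows "recurrent S (\<phi> 0)"
proof -
  let ?X = "subtopology compact_open_topology S"
  let ?F = "{\<psi> \<in> S. \<psi> 0 = \<phi> 0}"
  define C where "C t = ?X closure_of (\<Union>s\<in>{t..}. shift s ` ?F)" for t :: real
  define K where "K n = C (real n) \<inter> {\<psi> \<in> topspace ?X. eval0 \<psi> \<in> {\<phi> 0}}" for n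
  have comp_X: "compact_space ?X"
    using comp by (rule compact_space_subtopology)
  have top_X: "topspace ?X = S"
    using compactin_subset_topspace[OF comp] by (simp add: topspace_subtopology Int_absorb1)
  have cont: "continuous_map ?X euclidean eval0"
    by (rule continuous_map_from_subtopology[OF continuous_map_eval0])
  have C_mono: "C t \<subseteq> C s" if "s \<le> t" for s t
    unfolding C_def using that by (intro closure_of_mono UN_mono) auto
  have K_closed: "closedin ?X (K n)" for n
    unfolding K_def C_def
    by (intro closedin_Int closedin_closure_of closedin_continuous_map_preimage[OF cont]) simp
  have K_nonempty: "K n \<noteq> {}" for n
  proof -
    have "compactin ?X (C (real n))"
      unfolding C_def by (intro closedin_compact_space comp_X closedin_closure_of)
    then have "compactin euclidean (eval0 ` C (real n))"
      using cont by (rule image_compactin)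
    then have closed: "closed (eval0 ` C (real n))"
      by (simp add: compactin_euclidean_iff compact_imp_closed)
    have "\<exists>y\<in>eval0 ` C (real n). dist y (\<phi> 0) < e" if e: "e > 0" for e
    proof -
      obtain k where k: "k \<ge> n" "dist (\<phi> (real k)) (\<phi> 0) < e"
        using ret e by blast
      have "(\<Union>s\<in>{real n..}. shift s ` ?F) \<subseteq> topspace ?X"
        unfolding top_X using inv by (intro UN_least) (auto simp: shift_invariant_def)
      then have "(\<Union>s\<in>{real n..}. shift s ` ?F) \<subseteq> C (real n)"
        unfolding C_def by (rule closure_of_subset)
      moreover have "shift (real k) \<phi> \<in> (\<Union>s\<in>{real n..}. shift s ` ?F)"
        using k(1) \<phi> by (intro UN_I[of "real k"] imageI) simp_all
      ultimately have "shift (real k) \<phi> \<in> C (real n)"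
        by (rule subsetD)
      moreover have "eval0 (shift (real k) \<phi>) = \<phi> (real k)"
        by (simp add: eval0_def shift_def)
      ultimately show ?thesis
        using k(2) by (intro bexI[of _ "\<phi> (real k)"] image_eqI[of _ _ "shift (real k) \<phi>"]) simp_all
    qed
    then have "\<phi> 0 \<in> closure (eval0 ` C (real n))"
      by (simp add: closure_approachable)
    then have "\<phi> 0 \<in> eval0 ` C (real n)"
      using closed by simp
    moreover have "C (real n) \<subseteq> topspace ?X"
      unfolding C_def by (rule closure_of_subset_topspace)
    ultimately show ?thesis
      unfolding K_def by force
  qed
  have "decseq K"
    unfolding decseq_def K_def using C_mono by (meson Int_mono of_nat_le_iff order_refl)
  then have "(\<Inter>n. K n) \<noteq> {}"
    by (intro compact_space_imp_nest[OF comp_X] K_closed K_nonempty)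
  then obtain \<psi> where \<psi>: "\<And>n. \<psi> \<in> K n"
    by blast
  \<comment> \<open>Integer tails are cofinal among the real ones.\<close>
  have "\<psi> \<in> C t" for t
    using \<psi>[of "nat \<lceil>t\<rceil>"] C_mono[of t "real (nat \<lceil>t\<rceil>)"] real_nat_ceiling_ge[of t]
    unfolding K_def by blast
  then have "\<psi> \<in> omega_limit S ?F"
    by (simp add: omega_limit_def C_def)
  moreover have "eval0 \<psi> = \<phi> 0"
    using \<psi>[of 0] by (simp add: K_def)
  ultimately show ?thesis
    unfolding recurrent_def omega_point_def by (intro image_eqI[of _ _ \<psi>]) simp_all
qed

section \<open>Full measure of the closure of the recurrent points\<close>

theorem theoremD:
  fixes S :: "(real \<Rightarrow> 'a::metric_space) set"
    and \<mu> :: "'a measure"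
  assumes "separable_space (euclidean :: 'a topology)"
    and "compactin compact_open_topology S"
    and "shift_invariant S"
    and "invariant_measure S \<mu>"
  shows "measure \<mu> (closure {x. recurrent S x}) = 1"
proof -
  obtain \<nu> where \<mu>: "prob_space \<mu>" "sets \<mu> = sets borel" "\<mu> = distr \<nu> borel eval0"
    and \<nu>: "prob_space \<nu>" "sets \<nu> = sets (borel_on S)" "\<And>t. distr \<nu> \<nu> (shift t) = \<nu>"
    using assms(4) by (auto simp: invariant_measure_def)
  have S: "S \<subseteq> topspace compact_open_topology"
    using assms(2) by (rule compactin_subset_topspace)
  have space_\<nu>: "space \<nu> = S"
    using sets_eq_imp_space_eq[OF \<nu>(2)] by (simp add: space_borel_on)
  have eval_meas: "eval0 \<in> borel_measurable \<nu>"
    using measurable_eval0[OF S] by (subst measurable_cong_sets[OF \<nu>(2) refl])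
  have "AE \<phi> in \<nu>. \<forall>e>0. \<forall>n. \<exists>k\<ge>n. dist (\<phi> (real k)) (\<phi> 0) < e"
    using \<nu> by (intro AE_returns_near_start[OF assms(1) S assms(3)])
      (auto intro: prob_space.finite_measure)
  then have "AE \<phi> in \<nu>. eval0 \<phi> \<in> closure {x. recurrent S x}"
  proof (rule AE_mp, intro AE_I2 impI)
    fix \<phi> assume "\<phi> \<in> space \<nu>" "\<forall>e>0. \<forall>n. \<exists>k\<ge>n. dist (\<phi> (real k)) (\<phi> 0) < e"
    then have "recurrent S (\<phi> 0)"
      by (intro recurrent_if_returns[OF assms(2,3)]) (simp_all add: space_\<nu>)
    then show "eval0 \<phi> \<in> closure {x. recurrent S x}"
      unfolding eval0_def by (intro subsetD[OF closure_subset]) simp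
  qed
  then have "AE x in \<mu>. x \<in> closure {x. recurrent S x}"
    unfolding \<mu>(3) by (subst AE_distr_iff[OF eval_meas]) simp_all
  then show ?thesis
    using prob_space.prob_eq_1[OF \<mu>(1)] \<mu>(2) by simp
qed

end
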